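(* Fix $N\ge1$ and consider prefixes for $I_N=\mathrm{Av}_N(231)$. For every eligible prefix $p$, \[ S_N(p)=\bigoplus_{q\ \text{successor of}\ p} S_N(q), \] where the sum is taken in the sense of pairs of integers.
   Context: Permutations of $[N]$ are written in one-line notation; $\mathrm{Av}_N(231)$ is the set of permutations $\pi$ of $[N]$ with no indices $a<b<c$ such that $\pi_c<\pi_a<\pi_b$. The $i$th prefix flattening $\pi|_{[i]}$ is the permutation of $[i]$ in the same relative order as $\pi_1,\dots,\pi_i$. A prefix (for $I_N$) is a permutation $p$ of $[k]$, $1\le k\le N$, with $p=\pi|_{[k]}$ for some $\pi\in I_N$; $k$ is its size. A prefix $p=p_1\cdots p_k$ is eligible if $p_k=k$. The strike probability $S_N(p)$ of a prefix $p$ of size $k$ is the pair of integers (numerator, denominator) $=\big(\#\{\pi\in I_N:\pi|_{[k]}=p,\ \pi_k=N\},\ \#\{\pi\in I_N:\pi|_{[k]}=p\}\big)$, and such pairs are added by $\frac ab\oplus\frac cd=\frac{a+c}{b+d}$. For an eligible prefix $p$ of size $k$, a successor of $p$ is a prefix $q$ of some size $m>k$ with $q|_{[k]}=p$, such that $q|_{[j]}$ is not eligible for every $k<j<m$, and such that $q$ is either eligible or has size $m=N$.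
   Formalization: The eligible prefix p is assumed to have size less than N; an eligible prefix of size N has no successors, so the sum would be the empty sum (0,0) while S_N(p) = (1,1), and the identity fails. *)

theory Defs
  imports "HOL-Combinatorics.Multiset_Permutations" "HOL-Library.Product_Plus"
begin

text \<open>
  A permutation of \<open>[N]\<close> in one-line notation is an element of \<open>permutations_of_set {1..N}\<close>,
  i.e. a list with entries \<open>1..N\<close>. Values are 1-based as usual, but list positions are 0-based:
  the entry \<open>\<pi>\<^sub>i\<close> is \<open>\<pi> ! (i - 1)\<close>.
\<close>

definition avoids_231 :: "nat list \<Rightarrow> bool" where
  "avoids_231 \<pi> \<longleftrightarrow>
     \<not> (\<exists>a b c. a < b \<and> b < c \<and> c < length \<pi> \<and> \<pi> ! c < \<pi> ! a \<and> \<pi> ! a < \<pi> ! b)"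

definition Av231 :: "nat \<Rightarrow> nat list set" where
  "Av231 N = {\<pi> \<in> permutations_of_set {1..N}. avoids_231 \<pi>}"

definition same_relative_order :: "nat list \<Rightarrow> nat list \<Rightarrow> bool" where
  "same_relative_order xs ys \<longleftrightarrow> length xs = length ys \<and>
     (\<forall>a < length xs. \<forall>b < length xs. xs ! a < xs ! b \<longleftrightarrow> ys ! a < ys ! b)"

text \<open>The prefix flattening \<open>\<pi>|\<^sub>[\<^sub>i\<^sub>]\<close>; the lemma \<open>flatten_prefix_ex1\<close> below shows that it is
  well defined.\<close>

definition flatten_prefix :: "nat \<Rightarrow> nat list \<Rightarrow> nat list" where
  "flatten_prefix i \<pi> =
     (THE q. q \<in> permutations_of_set {1..i} \<and> same_relative_order q (take i \<pi>))"

text \<open>In what follows \<open>I\<close> stands for the class \<open>I\<^sub>N\<close> of permutations of \<open>[N]\<close>.\<close>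

definition is_prefix :: "nat list set \<Rightarrow> nat \<Rightarrow> nat list \<Rightarrow> bool" where
  "is_prefix I N p \<longleftrightarrow> 1 \<le> length p \<and> length p \<le> N \<and>
     p \<in> permutations_of_set {1..length p} \<and> (\<exists>\<pi>\<in>I. p = flatten_prefix (length p) \<pi>)"

definition eligible :: "nat list \<Rightarrow> bool" where
  "eligible p \<longleftrightarrow> p ! (length p - 1) = length p"

text \<open>The pair (numerator, denominator), not a quotient. The mediant operation \<open>\<oplus>\<close> on such pairs
  is the componentwise addition on \<open>int \<times> int\<close> from \<open>Product_Plus\<close>.\<close>

definition strike_prob :: "nat list set \<Rightarrow> nat \<Rightarrow> nat list \<Rightarrow> int \<times> int" where
  "strike_prob I N p =
     (int (card {\<pi> \<in> I. flatten_prefix (length p) \<pi> = p \<and> \<pi> ! (length p - 1) = N}),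
      int (card {\<pi> \<in> I. flatten_prefix (length p) \<pi> = p}))"

definition successors :: "nat list set \<Rightarrow> nat \<Rightarrow> nat list \<Rightarrow> nat list set" where
  "successors I N p =
     {q. is_prefix I N q \<and> length p < length q \<and> flatten_prefix (length p) q = p \<and>
         (\<forall>j. length p < j \<and> j < length q \<longrightarrow> \<not> eligible (flatten_prefix j q)) \<and>
         (eligible q \<or> length q = N)}"

lemma finite_successors: "finite (successors I N p)"
proof (rule finite_subset)
  show "successors I N p \<subseteq> (\<Union>k\<in>{..N}. permutations_of_set {1..k})"
    by (auto simp: successors_def is_prefix_def)
qed auto

definition rank_in :: "nat set \<Rightarrow> nat \<Rightarrow> nat" where
  "rank_in A x = card {y \<in> A. y \<le> x}"

lemma rank_in_less_iff:
  assumes "finite A" "x \<in> A" "y \<in> A"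
  shows "rank_in A x < rank_in A y \<longleftrightarrow> x < y"
proof -
  have mono: "rank_in A x \<le> rank_in A y" if "x \<le> y" for x y
    unfolding rank_in_def using assms(1) that by (intro card_mono) auto
  have "rank_in A x < rank_in A y" if "x < y"
    unfolding rank_in_def using assms that by (intro psubset_card_mono) force+
  with mono[of y x] show ?thesis by (meson not_le)
qed

lemma rank_in_perm:
  assumes "x \<in> {1..n}"
  shows "rank_in {1..n} x = x"
proof -
  have "{y \<in> {1..n}. y \<le> x} = {1..x}" using assms by auto
  then show ?thesis by (simp add: rank_in_def)
qed

lemma same_relative_order_rank:
  assumes "same_relative_order xs ys" "distinct xs" "distinct ys"
  shows "map (rank_in (set xs)) xs = map (rank_in (set ys)) ys"
proof (rule nth_equalityI)
  have len: "length xs = length ys" using assms by (simp add: same_relative_order_def)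
  then show "length (map (rank_in (set xs)) xs) = length (map (rank_in (set ys)) ys)" by simp
  have rank: "rank_in (set zs) (zs ! i) = card {j. j < length zs \<and> \<not> zs ! i < zs ! j}"
    if "distinct zs" for zs :: "nat list" and i
  proof -
    have "{y \<in> set zs. y \<le> zs ! i} = (!) zs ` {j. j < length zs \<and> \<not> zs ! i < zs ! j}"
      by (auto simp: in_set_conv_nth image_iff not_less)
    moreover have "inj_on ((!) zs) {j. j < length zs \<and> \<not> zs ! i < zs ! j}"
      using that by (auto simp: inj_on_def nth_eq_iff_index_eq)
    ultimately show ?thesis by (simp add: rank_in_def card_image)
  qed
  fix i assume i: "i < length (map (rank_in (set xs)) xs)"
  have "{j. j < length xs \<and> \<not> xs ! i < xs ! j} = {j. j < length ys \<and> \<not> ys ! i < ys ! j}"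
    using assms(1) i by (auto simp: same_relative_order_def)
  then show "map (rank_in (set xs)) xs ! i = map (rank_in (set ys)) ys ! i"
    using i len rank[OF assms(2), of i] rank[OF assms(3), of i] by simp
qed

lemma standardization_iff:
  assumes "distinct ys" "length ys = i"
  shows "q \<in> permutations_of_set {1..i} \<and> same_relative_order q ys \<longleftrightarrow>
         q = map (rank_in (set ys)) ys"
proof
  assume q: "q \<in> permutations_of_set {1..i} \<and> same_relative_order q ys"
  then have "set q = {1..i}" "distinct q" by (auto simp: permutations_of_set_def)
  moreover from this have "map (rank_in (set q)) q = q"
    by (intro map_idI) (metis rank_in_perm)
  ultimately show "q = map (rank_in (set ys)) ys"
    using same_relative_order_rank[of q ys] q assms(1) by simp
next
  let ?q = "map (rank_in (set ys)) ys"
  assume q: "q = ?q"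
  have inj: "inj_on (rank_in (set ys)) (set ys)"
    by (rule inj_onI) (metis List.finite_set linorder_neq_iff rank_in_less_iff)
  have card: "card (set ys) = i" using assms by (simp add: distinct_card)
  have "set ?q \<subseteq> {1..i}"
  proof
    fix z assume "z \<in> set ?q"
    then obtain y where y: "y \<in> set ys" "z = rank_in (set ys) y" by auto
    have "card {y} \<le> rank_in (set ys) y"
      unfolding rank_in_def using y by (intro card_mono) auto
    moreover have "rank_in (set ys) y \<le> card (set ys)"
      unfolding rank_in_def by (intro card_mono) auto
    ultimately show "z \<in> {1..i}" using y card by simp
  qed
  moreover have "card (set ?q) = i" using card_image[OF inj] card by simp
  ultimately have "set ?q = {1..i}" by (intro card_subset_eq) auto
  moreover have "distinct ?q" using inj assms(1) by (simp add: distinct_map)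
  ultimately show "q \<in> permutations_of_set {1..i} \<and> same_relative_order q ys"
    using q by (auto simp: permutations_of_set_def same_relative_order_def rank_in_less_iff)
qed

lemma flatten_prefix_ex1:
  assumes "distinct \<pi>" "i \<le> length \<pi>"
  shows "\<exists>!q. q \<in> permutations_of_set {1..i} \<and> same_relative_order q (take i \<pi>)"
  using standardization_iff[of "take i \<pi>" i] assms by auto

end

theory Submission
  imports Defs
begin

text \<open>
  Every \<open>\<pi>\<close> with prefix \<open>p\<close> passes through exactly one successor of \<open>p\<close>, namely the flattening at
  the first left-to-right maximum after position \<open>k = length p\<close> (or at \<open>N\<close>). This settles the
  denominators. For the numerators one has to match the \<open>\<pi>\<close> with \<open>\<pi>\<^sub>k = N\<close> with those whose first
  left-to-right maximum after position \<open>k\<close> is \<open>N\<close>. In the latter case let \<open>v = \<pi>\<^sub>k\<close>. Moving the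
  value \<open>v\<close> to the top (and closing the gap) gives a permutation of the former kind. The map can be
  undone because avoidance of 231 forces \<open>v\<close> to be the number of entries before \<open>N\<close>, and this
  position is the position of \<open>N - 1\<close> in the image.
\<close>

section \<open>Prefix flattening\<close>

lemma flatten_prefix_spec:
  assumes "distinct \<pi>" "i \<le> length \<pi>"
  shows "flatten_prefix i \<pi> \<in> permutations_of_set {1..i}"
    and "same_relative_order (flatten_prefix i \<pi>) (take i \<pi>)"
  using theI'[OF flatten_prefix_ex1[OF assms]] unfolding flatten_prefix_def by auto

lemma flatten_prefix_eq_iff:
  assumes "distinct \<pi>" "i \<le> length \<pi>" "q \<in> permutations_of_set {1..i}"
  shows "flatten_prefix i \<pi> = q \<longleftrightarrow> same_relative_order q (take i \<pi>)"
  using flatten_prefix_spec[OF assms(1,2)] flatten_prefix_ex1[OF assms(1,2)] assms(3) by blast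

lemma permutation_of_interval:
  assumes "q \<in> permutations_of_set {1..n}"
  shows "length q = n" "distinct q" "set q = {1..n}"
  using assms distinct_card[of q] by (auto simp: permutations_of_set_def)

lemma flatten_prefix_flatten_prefix:
  assumes "distinct \<pi>" "j \<le> length \<pi>" "i \<le> j"
  shows "flatten_prefix i (flatten_prefix j \<pi>) = flatten_prefix i \<pi>"
proof -
  note q = flatten_prefix_spec[OF assms(1,2)]
  note q' = permutation_of_interval[OF q(1)]
  have i: "i \<le> length \<pi>" using assms by simp
  note r = flatten_prefix_spec[OF assms(1) i]
  have "same_relative_order (flatten_prefix i \<pi>) (take i (flatten_prefix j \<pi>))"
    using q(2) r(2) q'(1) assms by (auto simp: same_relative_order_def)
  then show ?thesis
    using flatten_prefix_eq_iff[of "flatten_prefix j \<pi>" i "flatten_prefix i \<pi>"] q' r(1) assms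
    by simp
qed

section \<open>Eligibility as a left-to-right maximum condition\<close>

lemma eligible_permutation_iff:
  assumes "q \<in> permutations_of_set {1..Suc j}"
  shows "eligible q \<longleftrightarrow> (\<forall>i<j. q ! i < q ! j)"
proof -
  note q = permutation_of_interval[OF assms]
  have ub: "q ! i \<le> Suc j" if "i < Suc j" for i
    using nth_mem[of i q] q that by simp
  show ?thesis
  proof
    assume e: "eligible q"
    show "\<forall>i<j. q ! i < q ! j"
    proof (intro allI impI)
      fix i assume "i < j"
      then show "q ! i < q ! j"
        using ub[of i] e q(1) nth_eq_iff_index_eq[OF q(2), of i j]
        by (simp add: eligible_def)
    qed
  next
    assume m: "\<forall>i<j. q ! i < q ! j"
    have "Suc j \<in> set q" using q(3) by simp
    then obtain i where i: "i < Suc j" "q ! i = Suc j"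
      using q(1) by (auto simp: in_set_conv_nth)
    with m ub[of j] have "i = j" by (metis less_antisym lessI not_less)
    with i q(1) show "eligible q" by (simp add: eligible_def)
  qed
qed

text \<open>Flattening preserves all comparisons, so eligibility becomes a left-to-right maximum
  condition on \<open>\<pi>\<close> itself.\<close>

lemma eligible_flatten_prefix_iff:
  assumes "distinct \<pi>" "j < length \<pi>"
  shows "eligible (flatten_prefix (Suc j) \<pi>) \<longleftrightarrow> (\<forall>i<j. \<pi> ! i < \<pi> ! j)"
proof -
  have "Suc j \<le> length \<pi>" using assms by simp
  note q = flatten_prefix_spec[OF assms(1) this]
  show ?thesis
    unfolding eligible_permutation_iff[OF q(1)]
    using q(2) assms(2) permutation_of_interval(1)[OF q(1)]
    by (auto simp: same_relative_order_def)
qed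

text \<open>The first entry after index \<open>K\<close> that exceeds \<open>\<pi> ! K\<close>
  exceeds everything before it, so it would be a left-to-right maximum. Strong induction on the
  index replaces the choice of a first one.\<close>

lemma no_record_between_iff:
  fixes \<pi> :: "nat list"
  assumes "distinct \<pi>" "K < M" "M \<le> length \<pi>" "\<forall>i<K. \<pi> ! i < \<pi> ! K"
  shows "(\<forall>j. K < j \<and> j < M \<longrightarrow> \<not> (\<forall>i<j. \<pi> ! i < \<pi> ! j)) \<longleftrightarrow>
         (\<forall>j. K < j \<and> j < M \<longrightarrow> \<pi> ! j < \<pi> ! K)"
proof
  assume *: "\<forall>j. K < j \<and> j < M \<longrightarrow> \<not> (\<forall>i<j. \<pi> ! i < \<pi> ! j)"
  have "K < j \<and> j < M \<longrightarrow> \<pi> ! j < \<pi> ! K" for j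
  proof (induction j rule: less_induct)
    case (less j)
    show ?case
    proof (rule ccontr)
      assume "\<not> ?thesis"
      then have j: "K < j" "j < M" and ge: "\<pi> ! K \<le> \<pi> ! j" by auto
      have gt: "\<pi> ! K < \<pi> ! j"
        using ge j assms nth_eq_iff_index_eq[OF assms(1), of K j] by simp
      have "\<pi> ! i < \<pi> ! j" if "i < j" for i
        using less.IH[OF that] that assms(4) j gt
        by (metis less_trans linorder_neqE_nat)
      with * j show False by blast
    qed
  qed
  then show "\<forall>j. K < j \<and> j < M \<longrightarrow> \<pi> ! j < \<pi> ! K" by blast
next
  assume "\<forall>j. K < j \<and> j < M \<longrightarrow> \<pi> ! j < \<pi> ! K"
  then show "\<forall>j. K < j \<and> j < M \<longrightarrow> \<not> (\<forall>i<j. \<pi> ! i < \<pi> ! j)"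
    by (metis less_asym)
qed

section \<open>Moving a value to the top\<close>

text \<open>On \<open>{1..N}\<close>, for \<open>v\<close> in that set, this is the cyclic rotation
  of \<open>{v..N}\<close> that sends \<open>v\<close> to \<open>N\<close>;
  \<open>lower_from_top\<close> is its inverse.\<close>

definition raise_to_top :: "nat \<Rightarrow> nat \<Rightarrow> nat \<Rightarrow> nat" where
  "raise_to_top N v x = (if x = v then N else if v < x then x - 1 else x)"

definition lower_from_top :: "nat \<Rightarrow> nat \<Rightarrow> nat \<Rightarrow> nat" where
  "lower_from_top N v x = (if x = N then v else if v \<le> x then x + 1 else x)"

lemma raise_lower_inverse:
  assumes "v \<in> {1..N}"
  shows "x \<in> {1..N} \<Longrightarrow> lower_from_top N v (raise_to_top N v x) = x"
    and "x \<in> {1..N} \<Longrightarrow> raise_to_top N v (lower_from_top N v x) = x"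
  using assms by (auto simp: raise_to_top_def lower_from_top_def)

lemma bij_betw_raise_to_top:
  assumes "v \<in> {1..N}"
  shows "bij_betw (raise_to_top N v) {1..N} {1..N}"
  using raise_lower_inverse[OF assms] assms
  by (intro bij_betw_byWitness[where f' = "lower_from_top N v"])
    (auto simp: raise_to_top_def lower_from_top_def)

lemma bij_betw_lower_from_top:
  assumes "v \<in> {1..N}"
  shows "bij_betw (lower_from_top N v) {1..N} {1..N}"
  using raise_lower_inverse[OF assms] assms
  by (intro bij_betw_byWitness[where f' = "raise_to_top N v"])
    (auto simp: raise_to_top_def lower_from_top_def)

lemma map_permutation:
  assumes "bij_betw f A A" "\<pi> \<in> permutations_of_set A"
  shows "map f \<pi> \<in> permutations_of_set A"
  using assms by (auto simp: permutations_of_set_def bij_betw_def distinct_map)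

text \<open>The rotation disturbs only comparisons with the moved value. A triple of entries can
  therefore gain or lose the pattern 231 only if it uses that value.\<close>

lemma raise_to_top_less_iff:
  assumes "x \<noteq> v" "y \<noteq> v"
  shows "raise_to_top N v x < raise_to_top N v y \<longleftrightarrow> x < y"
  using assms by (auto simp: raise_to_top_def)

lemma lower_from_top_less_iff:
  assumes "x \<noteq> N" "y \<noteq> N"
  shows "lower_from_top N v x < lower_from_top N v y \<longleftrightarrow> x < y"
  using assms by (auto simp: lower_from_top_def)

section \<open>Positions and values forced by avoidance of 231\<close>

text \<open>A positive \<open>x \<le> Max A\<close> outside \<open>A\<close> would have to lie above
  \<open>Max A\<close>, so \<open>A\<close> is \<open>{1..Max A}\<close>. This turns comparisons
  between earlier and later entries into an exact set of values.\<close>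

lemma initial_segment_eq:
  fixes A :: "nat set"
  assumes "A \<subseteq> {1..N}" "\<And>a b. a \<in> A \<Longrightarrow> b \<in> {1..N} - A \<Longrightarrow> a < b"
  shows "A = {1..card A}"
proof (cases "A = {}")
  case False
  have fin: "finite A" using assms(1) finite_subset by blast
  have "A = {1..Max A}"
  proof
    show "A \<subseteq> {1..Max A}" using assms(1) fin by auto
    show "{1..Max A} \<subseteq> A"
    proof
      fix x assume x: "x \<in> {1..Max A}"
      have "Max A \<in> A" using fin False by simp
      with assms(1) x assms(2)[of "Max A" x] show "x \<in> A" by force
    qed
  qed
  then show ?thesis by (metis card_atLeastAtMost diff_Suc_1)
qed simp

lemma avoids_231D:
  assumes "avoids_231 \<pi>" "a < b" "b < c" "c < length \<pi>" "\<pi> ! a < \<pi> ! b"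
  shows "\<pi> ! a \<le> \<pi> ! c"
  using assms unfolding avoids_231_def by (meson not_less)

text \<open>Here \<open>K\<close> is the 0-based index \<open>k - 1\<close> of the last entry of the prefix, and \<open>M\<close> is that of \<open>N\<close>.\<close>

definition next_record_top :: "nat \<Rightarrow> nat \<Rightarrow> nat list set" where
  "next_record_top N K = {\<pi> \<in> Av231 N. \<exists>M. K < M \<and> M < N \<and> \<pi> ! M = N \<and>
     (\<forall>j. j < M \<and> j \<noteq> K \<longrightarrow> \<pi> ! j < \<pi> ! K)}"

lemma Av231_facts:
  assumes "\<pi> \<in> Av231 N"
  shows "length \<pi> = N" "distinct \<pi>" "set \<pi> = {1..N}" "avoids_231 \<pi>"
    "\<And>i. i < N \<Longrightarrow> 1 \<le> \<pi> ! i \<and> \<pi> ! i \<le> N"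
    "\<And>i j. i < N \<Longrightarrow> j < N \<Longrightarrow> \<pi> ! i = \<pi> ! j \<longleftrightarrow> i = j"
proof -
  have p: "\<pi> \<in> permutations_of_set {1..N}" and av: "avoids_231 \<pi>"
    using assms by (auto simp: Av231_def)
  note q = permutation_of_interval[OF p]
  show "length \<pi> = N" "distinct \<pi>" "set \<pi> = {1..N}" "avoids_231 \<pi>" by fact+
  show "\<And>i. i < N \<Longrightarrow> 1 \<le> \<pi> ! i \<and> \<pi> ! i \<le> N"
    using q nth_mem by fastforce
  show "\<And>i j. i < N \<Longrightarrow> j < N \<Longrightarrow> \<pi> ! i = \<pi> ! j \<longleftrightarrow> i = j"
    using q nth_eq_iff_index_eq by blast
qed

text \<open>With \<open>N\<close> at index \<open>M\<close> in the role of the 3, avoidance forces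
  every entry before \<open>M\<close> to be below every entry after it. So the \<open>M\<close>
  entries before \<open>N\<close> are exactly \<open>1, ..., M\<close>, and \<open>\<pi> ! K\<close>
  is the largest of them.\<close>

lemma entry_eq_index_of_top:
  assumes \<pi>: "\<pi> \<in> Av231 N" and M: "K < M" "M < N" "\<pi> ! M = N"
    and max: "\<And>j. j < M \<Longrightarrow> j \<noteq> K \<Longrightarrow> \<pi> ! j < \<pi> ! K"
  shows "\<pi> ! K = M"
proof -
  note A = Av231_facts[OF \<pi>]
  let ?S = "(!) \<pi> ` {..<M}"
  have card: "card ?S = M"
    using A(6) M by (subst card_image) (auto simp: inj_on_def)
  have "?S = {1..card ?S}"
  proof (rule initial_segment_eq)
    show "?S \<subseteq> {1..N}" using A(5) M by auto
    fix a b assume a: "a \<in> ?S" and b: "b \<in> {1..N} - ?S"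
    from a obtain i where i: "i < M" "a = \<pi> ! i" by auto
    from b obtain j where j: "j < N" "b = \<pi> ! j" "\<not> j < M"
      using A(1,3) by (metis DiffD1 DiffD2 image_eqI in_set_conv_nth lessThan_iff)
    have iN: "\<pi> ! i < N" using A(5,6)[of i] A(6)[of i M] i M by fastforce
    show "a < b"
    proof (cases "j = M")
      case False
      then have "\<pi> ! i \<le> \<pi> ! j"
        using avoids_231D[OF A(4), of i M j] iN i j M A(1) by simp
      moreover have "\<pi> ! i \<noteq> \<pi> ! j" using A(6) i j M by simp
      ultimately show ?thesis using i j by simp
    qed (use iN i j M in simp)
  qed
  then have S: "?S = {1..M}" using card by simp
  then have "M \<in> ?S" using M by simp
  then obtain i where i: "i < M" "\<pi> ! i = M" by auto
  have "\<pi> ! K \<in> ?S" using M by simp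
  then have "\<pi> ! K \<le> M" using S by simp
  with max[of i] i show ?thesis by (cases "i = K") auto
qed

text \<open>In the image \<open>N\<close> stands at index \<open>K\<close>, so this index can only
  play the 3 in a 231. As \<open>\<pi> ! K\<close> already exceeds all earlier entries, any 231 in
  the image sits at the same indices in \<open>\<pi>\<close>.\<close>

lemma raise_mem_Av231:
  assumes \<pi>: "\<pi> \<in> Av231 N" and "K < N" and max: "\<And>j. j < K \<Longrightarrow> \<pi> ! j < \<pi> ! K"
  shows "map (raise_to_top N (\<pi> ! K)) \<pi> \<in> Av231 N"
proof -
  note A = Av231_facts[OF \<pi>]
  let ?v = "\<pi> ! K" and ?f = "raise_to_top N (\<pi> ! K)"
  have v: "?v \<in> {1..N}" using A(5) assms(2) by simp
  have perm: "map ?f \<pi> \<in> permutations_of_set {1..N}"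
    using \<pi> by (intro map_permutation bij_betw_raise_to_top v) (simp add: Av231_def)
  have top: "?f x \<le> N" if "x \<in> {1..N}" for x
    using that v by (auto simp: raise_to_top_def)
  have fv: "?f ?v = N" by (simp add: raise_to_top_def)
  have "avoids_231 (map ?f \<pi>)"
    unfolding avoids_231_def
  proof
    assume "\<exists>a b c. a < b \<and> b < c \<and> c < length (map ?f \<pi>) \<and>
      map ?f \<pi> ! c < map ?f \<pi> ! a \<and> map ?f \<pi> ! a < map ?f \<pi> ! b"
    then obtain a b c where abc: "a < b" "b < c" "c < N"
      and ca: "?f (\<pi> ! c) < ?f (\<pi> ! a)" and ab: "?f (\<pi> ! a) < ?f (\<pi> ! b)"
      using A(1) by auto
    have aN: "a < N" and bN: "b < N" using abc by auto
    have "?f (\<pi> ! b) \<le> N" "?f (\<pi> ! a) \<le> N" using top A(5) aN bN by auto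
    then have ne: "a \<noteq> K" "c \<noteq> K" using ab ca fv by auto
    then have nv: "\<pi> ! a \<noteq> ?v" "\<pi> ! c \<noteq> ?v" using A(6) aN abc assms(2) by auto
    have ca': "\<pi> ! c < \<pi> ! a" using ca raise_to_top_less_iff[OF nv(2,1)] by simp
    have "\<pi> ! a < \<pi> ! b"
    proof (cases "b = K")
      case True then show ?thesis using max abc by simp
    next
      case False
      then have "\<pi> ! b \<noteq> ?v" using A(6) bN assms(2) by auto
      then show ?thesis using ab raise_to_top_less_iff[OF nv(1)] by simp
    qed
    then show False using avoids_231D[OF A(4) abc(1,2)] abc A(1) ca' by force
  qed
  then show ?thesis using perm by (simp add: Av231_def)
qed

text \<open>The index \<open>v\<close> of \<open>N - 1\<close> serves at the same time as the value that replaces \<open>N\<close>.\<close>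

lemma lower_mem:
  assumes \<pi>: "\<pi> \<in> Av231 N" and K: "Suc K < N" "\<pi> ! K = N"
    and v: "v < N" "\<pi> ! v = N - 1"
  shows "map (lower_from_top N v) \<pi> \<in> next_record_top N K" and "K < v"
proof -
  note A = Av231_facts[OF \<pi>]
  have lt: "\<pi> ! j < N - 1" if "j < N" "j \<noteq> K" "j \<noteq> v" for j
  proof -
    have "\<pi> ! j \<le> N" "\<pi> ! j \<noteq> \<pi> ! K" "\<pi> ! j \<noteq> \<pi> ! v"
      using A(5)[of j] A(6)[of j K] A(6)[of j v] that K(1) v(1) by auto
    then show ?thesis using K v by linarith
  qed
  have "v \<noteq> K" using K v by auto
  \<comment> \<open>Since \<open>Suc K < N\<close>, some entry follows \<open>N\<close>; if
    \<open>N - 1\<close> came before \<open>N\<close>, these two and that entry would form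
    231.\<close>
  moreover have "\<not> v < K"
  proof
    assume "v < K"
    then have "\<pi> ! v \<le> \<pi> ! Suc K"
      using avoids_231D[OF A(4), of v K "Suc K"] K v A(1) by simp
    moreover have "\<pi> ! Suc K < N - 1" using lt[of "Suc K"] \<open>v < K\<close> K by simp
    ultimately show False using v by simp
  qed
  ultimately show Kv: "K < v" by simp
  \<comment> \<open>Now \<open>N - 1\<close> at index \<open>v\<close> plays the 3: every earlier
    entry except \<open>N\<close> is below every later one. As \<open>K < v\<close>, there are
    \<open>v - 1\<close> such earlier entries, and they take the values
    \<open>{1..v - 1}\<close>.\<close>
  let ?S = "(!) \<pi> ` ({..<v} - {K})"
  have card: "card ?S = v - 1"
    using A(6) v Kv by (subst card_image) (auto simp: inj_on_def)
  have "?S = {1..card ?S}"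
  proof (rule initial_segment_eq)
    show "?S \<subseteq> {1..N}" using A(5) v by auto
    fix a b assume a: "a \<in> ?S" and b: "b \<in> {1..N} - ?S"
    from a obtain i where i: "i < v" "i \<noteq> K" "a = \<pi> ! i" by auto
    from b obtain j where j: "j < N" "b = \<pi> ! j" "j < v \<longrightarrow> j = K"
      using A(1,3)
      by (metis DiffD1 DiffD2 DiffI image_eqI in_set_conv_nth lessThan_iff singletonD)
    have i1: "\<pi> ! i < N - 1" using lt i v by simp
    show "a < b"
    proof (cases "j = K \<or> j = v")
      case False
      then have "\<pi> ! i \<le> \<pi> ! j"
        using avoids_231D[OF A(4), of i v j] i1 i j v A(1) by simp
      moreover have "\<pi> ! i \<noteq> \<pi> ! j" using A(6) i j v False by auto
      ultimately show ?thesis using i j by simp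
    qed (use i1 i j v K in auto)
  qed
  then have S: "?S = {1..v - 1}" using card by simp
  have before: "\<pi> ! j < v" if "j < v" "j \<noteq> K" for j
  proof -
    have "\<pi> ! j \<in> ?S" using that by simp
    then show ?thesis using S Kv by auto
  qed
  have after: "v \<le> \<pi> ! j" if "v \<le> j" "j < N" for j
  proof (rule ccontr)
    assume "\<not> v \<le> \<pi> ! j"
    then have "\<pi> ! j \<in> ?S" using A(5) that unfolding S by auto
    then show False using A(6) that v by auto
  qed
  let ?g = "lower_from_top N v"
  \<comment> \<open>In the image index \<open>K\<close> carries \<open>v\<close>, all other indices
    before \<open>v\<close> carry smaller values, and the indices from \<open>v\<close> on carry
    larger ones, with \<open>N\<close> at index \<open>v\<close>.\<close>
  have gK: "?g (\<pi> ! K) = v" using K by (simp add: lower_from_top_def)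
  have gbefore: "?g (\<pi> ! j) < v" if "j < v" "j \<noteq> K" for j
    using before[OF that] v by (simp add: lower_from_top_def)
  have gafter: "v < ?g (\<pi> ! j)" if "v \<le> j" "j < N" for j
  proof -
    have "\<pi> ! j \<noteq> N" using A(6)[of j K] that K Kv by auto
    then show ?thesis using after[OF that] by (simp add: lower_from_top_def)
  qed
  have gv: "?g (\<pi> ! v) = N" using v after[of v] by (simp add: lower_from_top_def)
  have perm: "map ?g \<pi> \<in> permutations_of_set {1..N}"
    using \<pi> v Kv by (intro map_permutation bij_betw_lower_from_top) (auto simp: Av231_def)
  have "avoids_231 (map ?g \<pi>)"
    unfolding avoids_231_def
  proof
    assume "\<exists>a b c. a < b \<and> b < c \<and> c < length (map ?g \<pi>) \<and>
      map ?g \<pi> ! c < map ?g \<pi> ! a \<and> map ?g \<pi> ! a < map ?g \<pi> ! b"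
    then obtain a b c where abc: "a < b" "b < c" "c < N"
      and ca: "?g (\<pi> ! c) < ?g (\<pi> ! a)" and ab: "?g (\<pi> ! a) < ?g (\<pi> ! b)"
      using A(1) by auto
    have aN: "a < N" and bN: "b < N" using abc by auto
    have neN: "\<pi> ! j \<noteq> N" if "j < N" "j \<noteq> K" for j using A(6)[of j K] that K by auto
    \<comment> \<open>The entry \<open>v\<close> at index \<open>K\<close> cannot be the 2: anything
      larger sits at an index at least \<open>v\<close>, and all entries after that are larger than
      \<open>v\<close> too.\<close>
    have "a \<noteq> K"
    proof
      assume [simp]: "a = K"
      have "v \<le> b" using ab gK gbefore[of b] abc by force
      then have "v < ?g (\<pi> ! c)" using gafter[of c] abc by simp
      with ca gK show False by simp
    qed
    \<comment> \<open>Nor can it be the 1, since all entries before index \<open>K\<close> are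
      smaller than \<open>v\<close>.\<close>
    moreover have "c \<noteq> K"
    proof
      assume [simp]: "c = K"
      have "?g (\<pi> ! a) < v" using gbefore[of a] abc Kv by simp
      with ca gK show False by simp
    qed
    ultimately have nv: "\<pi> ! a \<noteq> N" "\<pi> ! c \<noteq> N" using neN aN abc by auto
    have ca': "\<pi> ! c < \<pi> ! a" using ca lower_from_top_less_iff[OF nv(2,1)] by simp
    have "\<pi> ! a < \<pi> ! b"
    proof (cases "b = K")
      case True
      then show ?thesis using nv A(5)[OF aN] K by simp
    next
      case False
      then show ?thesis using ab lower_from_top_less_iff[OF nv(1) neN[OF bN]] by simp
    qed
    then show False using avoids_231D[OF A(4) abc(1,2)] abc A(1) ca' by force
  qed
  then show "map ?g \<pi> \<in> next_record_top N K"
    unfolding next_record_top_def Av231_def using perm gv gK gbefore Kv v A(1)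
    by (auto intro!: exI[of _ v])
qed

section \<open>The bijection behind the numerators\<close>

text \<open>\<open>?F\<close> maps \<open>?B\<close> bijectively to \<open>?A\<close>. The fibre
  over \<open>p\<close> is kept because \<open>\<pi> ! K\<close> is already the largest of the first
  \<open>Suc K\<close> entries, so raising it leaves their relative order unchanged.\<close>

lemma card_next_record_top:
  assumes K: "Suc K < N"
  shows "card {\<pi> \<in> Av231 N. flatten_prefix (Suc K) \<pi> = p \<and> \<pi> ! K = N} =
         card {\<pi> \<in> next_record_top N K. flatten_prefix (Suc K) \<pi> = p}"
    (is "card ?A = card ?B")
proof -
  let ?F = "\<lambda>\<pi>. map (raise_to_top N (\<pi> ! K)) \<pi>"
  have sub: "next_record_top N K \<subseteq> Av231 N" by (auto simp: next_record_top_def)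
  have flat: "flatten_prefix (Suc K) (?F \<pi>) = flatten_prefix (Suc K) \<pi>"
    and top: "?F \<pi> \<in> Av231 N" "?F \<pi> ! K = N"
    if \<pi>: "\<pi> \<in> next_record_top N K" for \<pi>
  proof -
    have P: "\<pi> \<in> Av231 N" using \<pi> sub by blast
    note A = Av231_facts[OF P]
    have max: "\<pi> ! j < \<pi> ! K" if "j < K" for j
      using \<pi> that by (auto simp: next_record_top_def)
    show F: "?F \<pi> \<in> Av231 N" using raise_mem_Av231[OF P _ max] K by simp
    show FK: "?F \<pi> ! K = N" using K A(1) by (simp add: raise_to_top_def)
    note A' = Av231_facts[OF F]
    have "?F \<pi> ! a < ?F \<pi> ! b \<longleftrightarrow> \<pi> ! a < \<pi> ! b" if ab: "a < Suc K" "b < Suc K" for a b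
    proof -
      consider "a = K" | "a < K" "b = K" | "a < K" "b < K" using ab by linarith
      then show ?thesis
      proof cases
        case 1
        have "\<not> ?F \<pi> ! K < ?F \<pi> ! b" using FK A'(5)[of b] ab K by simp
        moreover have "\<not> \<pi> ! K < \<pi> ! b" using max[of b] ab by (cases "b = K") auto
        ultimately show ?thesis using 1 by blast
      next
        case 2
        have "?F \<pi> ! a \<le> N" "?F \<pi> ! a \<noteq> ?F \<pi> ! K" using A'(5)[of a] A'(6)[of a K] 2 K by auto
        then show ?thesis using 2 max[of a] FK by simp
      next
        case 3
        then show ?thesis
          using raise_to_top_less_iff max[of a] max[of b] A(1) K by simp
      qed
    qed
    then have "same_relative_order (take (Suc K) \<pi>) (take (Suc K) (?F \<pi>))"
      using A(1) K by (simp add: same_relative_order_def)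
    moreover have "same_relative_order (flatten_prefix (Suc K) \<pi>) (take (Suc K) \<pi>)"
      using flatten_prefix_spec(2) A K by simp
    ultimately have "same_relative_order (flatten_prefix (Suc K) \<pi>) (take (Suc K) (?F \<pi>))"
      by (simp add: same_relative_order_def)
    then show "flatten_prefix (Suc K) (?F \<pi>) = flatten_prefix (Suc K) \<pi>"
      using flatten_prefix_eq_iff[of "?F \<pi>" "Suc K" "flatten_prefix (Suc K) \<pi>"] A' A K
        flatten_prefix_spec(1)[of \<pi> "Suc K"] by simp
  qed
  have "bij_betw ?F ?B ?A"
    unfolding bij_betw_def
  proof
    \<comment> \<open>The original \<open>\<pi> ! K\<close> is recovered from the image: it equals
      the index of \<open>N\<close> in \<open>\<pi>\<close>, and the rotation turns that
      \<open>N\<close> into \<open>N - 1\<close>.\<close>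
    have idx: "\<pi> ! K < N \<and> ?F \<pi> ! (\<pi> ! K) = N - 1" if \<pi>: "\<pi> \<in> next_record_top N K" for \<pi>
    proof -
      have P: "\<pi> \<in> Av231 N" using \<pi> sub by blast
      from \<pi> obtain M where M: "K < M" "M < N" "\<pi> ! M = N"
        "\<And>j. j < M \<Longrightarrow> j \<noteq> K \<Longrightarrow> \<pi> ! j < \<pi> ! K" by (auto simp: next_record_top_def)
      have "\<pi> ! K = M" using entry_eq_index_of_top[OF P M] .
      then show ?thesis using M Av231_facts(1)[OF P] by (simp add: raise_to_top_def)
    qed
    show "inj_on ?F ?B"
    proof (rule inj_onI)
      fix \<pi> \<sigma> assume \<pi>: "\<pi> \<in> ?B" and \<sigma>: "\<sigma> \<in> ?B" and eq: "?F \<pi> = ?F \<sigma>"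
      have i: "\<pi> ! K < N" "?F \<pi> ! (\<pi> ! K) = N - 1" using idx \<pi> by auto
      have j: "\<sigma> ! K < N" "?F \<sigma> ! (\<sigma> ! K) = N - 1" using idx \<sigma> by auto
      have "?F \<pi> \<in> Av231 N" using top \<pi> by blast
      note F = Av231_facts(6)[OF this]
      \<comment> \<open>The entry \<open>N - 1\<close> occurs only once in the common image, so both
        sides used the same rotation.\<close>
      have vv: "\<pi> ! K = \<sigma> ! K" using F[OF i(1) j(1)] i(2) j(2) eq by simp
      have P: "\<pi> \<in> Av231 N" "\<sigma> \<in> Av231 N" using \<pi> \<sigma> sub by auto
      have "inj_on (raise_to_top N (\<pi> ! K)) {1..N}"
        using bij_betw_raise_to_top[of "\<pi> ! K" N] Av231_facts(5)[OF P(1), of K] K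
        by (simp add: bij_betw_def)
      then show "\<pi> = \<sigma>"
        using eq vv map_inj_on[of "raise_to_top N (\<pi> ! K)" \<pi> \<sigma>] Av231_facts(3)[OF P(1)]
          Av231_facts(3)[OF P(2)] by simp
    qed
    show "?F ` ?B = ?A"
    proof
      show "?F ` ?B \<subseteq> ?A" using flat top by auto
      show "?A \<subseteq> ?F ` ?B"
      proof
        fix \<pi> assume "\<pi> \<in> ?A"
        then have P: "\<pi> \<in> Av231 N" and fl: "flatten_prefix (Suc K) \<pi> = p" and PK: "\<pi> ! K = N"
          by auto
        note A = Av231_facts[OF P]
        have "N - 1 \<in> set \<pi>" using A(3) K by simp
        then obtain v where v: "v < N" "\<pi> ! v = N - 1" using A(1) by (auto simp: in_set_conv_nth)
        let ?\<sigma> = "map (lower_from_top N v) \<pi>"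
        note low = lower_mem[OF P K PK v]
        \<comment> \<open>The lowered entry at \<open>K\<close> is \<open>v\<close>, so
          \<open>?F\<close> raises exactly this value and undoes the lowering.\<close>
        have "?\<sigma> ! K = v" using PK A(1) K by (simp add: lower_from_top_def)
        then have F: "?F ?\<sigma> = \<pi>"
          using raise_lower_inverse(2)[of v N] v low(2) A(3) by (auto intro!: map_idI)
        then have "flatten_prefix (Suc K) ?\<sigma> = p" using flat[OF low(1)] fl by simp
        with low(1) have "?\<sigma> \<in> ?B" by simp
        then show "\<pi> \<in> ?F ` ?B" using F by (metis (no_types, lifting) imageI)
      qed
    qed
  qed
  then show ?thesis by (simp add: bij_betw_same_card)
qed

section \<open>Successors\<close>

text \<open>Of two successors of different size met by one \<open>\<pi>\<close>, the shorter is a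
  flattening of the longer. Having size below \<open>N\<close>, it is eligible, which the longer
  successor forbids for its intermediate prefixes.\<close>

lemma successors_disjoint:
  assumes "I \<subseteq> permutations_of_set {1..N}" "q \<in> successors I N p" "q' \<in> successors I N p"
    "\<pi> \<in> I" "flatten_prefix (length q) \<pi> = q" "flatten_prefix (length q') \<pi> = q'"
  shows "q = q'"
proof -
  have \<pi>: "distinct \<pi>" "length \<pi> = N" using assms permutation_of_interval by blast+
  have no: False
    if r: "r \<in> successors I N p" "s \<in> successors I N p" "length r < length s"
      "flatten_prefix (length r) \<pi> = r" "flatten_prefix (length s) \<pi> = s" for r s
  proof -
    have "length s \<le> N" using r by (auto simp: successors_def is_prefix_def)
    then have "flatten_prefix (length r) s = r" and "eligible r"
      using r \<pi> flatten_prefix_flatten_prefix[of \<pi> "length s" "length r"]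
      by (auto simp: successors_def)
    then show False using r by (auto simp: successors_def)
  qed
  have "length q = length q'"
    using no[of q q'] no[of q' q] assms by (meson linorder_neqE_nat)
  then show ?thesis using assms by metis
qed

lemma flatten_prefix_mem_successors:
  assumes I: "I \<subseteq> permutations_of_set {1..N}" and \<pi>: "\<pi> \<in> I" "flatten_prefix (length p) \<pi> = p"
    and m: "length p < m" "m \<le> N" "\<And>j. length p < j \<Longrightarrow> j < m \<Longrightarrow> \<not> eligible (flatten_prefix j \<pi>)"
    "eligible (flatten_prefix m \<pi>) \<or> m = N"
  shows "flatten_prefix m \<pi> \<in> successors I N p" "length (flatten_prefix m \<pi>) = m"
proof -
  have d: "distinct \<pi>" "length \<pi> = N" using I \<pi> permutation_of_interval by blast+
  have q: "flatten_prefix m \<pi> \<in> permutations_of_set {1..m}"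
    using flatten_prefix_spec(1) d m by simp
  show len: "length (flatten_prefix m \<pi>) = m" using permutation_of_interval(1)[OF q] .
  show "flatten_prefix m \<pi> \<in> successors I N p"
    unfolding successors_def is_prefix_def
    using m \<pi> q len d flatten_prefix_flatten_prefix[of \<pi> m] by auto
qed

text \<open>Existence half of the partition into successors; \<open>successors_disjoint\<close> is
  the uniqueness half.\<close>

lemma fibre_eq_UN_successors:
  assumes I: "I \<subseteq> permutations_of_set {1..N}" and p: "length p < N"
  shows "{\<pi> \<in> I. flatten_prefix (length p) \<pi> = p} =
         (\<Union>q\<in>successors I N p. {\<pi> \<in> I. flatten_prefix (length q) \<pi> = q})" (is "?L = ?R")
proof
  show "?L \<subseteq> ?R"
  proof
    fix \<pi> assume "\<pi> \<in> ?L"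
    then have \<pi>: "\<pi> \<in> I" "flatten_prefix (length p) \<pi> = p" by auto
    let ?P = "\<lambda>m. length p < m \<and> (eligible (flatten_prefix m \<pi>) \<or> m = N)"
    define m where "m = (LEAST m. ?P m)"
    \<comment> \<open>The size \<open>N\<close> always qualifies because \<open>p\<close> is
      shorter, so a least stopping size exists.\<close>
    have ex: "?P N" using p by simp
    have Pm: "?P m" unfolding m_def using ex by (rule LeastI)
    have le: "m \<le> N" unfolding m_def using ex by (rule Least_le)
    have "\<not> eligible (flatten_prefix j \<pi>)" if "length p < j" "j < m" for j
      using not_less_Least[of j ?P] that unfolding m_def by blast
    then have "flatten_prefix m \<pi> \<in> successors I N p" "length (flatten_prefix m \<pi>) = m"
      using flatten_prefix_mem_successors[OF I \<pi>, of m] Pm le by blast+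
    then show "\<pi> \<in> ?R" using \<pi>(1) by (intro UN_I[of "flatten_prefix m \<pi>"]) auto
  qed
  show "?R \<subseteq> ?L"
  proof
    fix \<pi> assume "\<pi> \<in> ?R"
    then obtain q where q: "q \<in> successors I N p" "\<pi> \<in> I" "flatten_prefix (length q) \<pi> = q"
      by auto
    have d: "distinct \<pi>" "length \<pi> = N" using I q permutation_of_interval by blast+
    have "flatten_prefix (length p) \<pi> = p"
      using flatten_prefix_flatten_prefix[of \<pi> "length q" "length p"] q d
      by (auto simp: successors_def is_prefix_def)
    then show "\<pi> \<in> ?L" using q by simp
  qed
qed

text \<open>\<open>N\<close> is a left-to-right maximum wherever it stands. When it stands after
  index \<open>K\<close>, it is therefore the last entry of a successor exactly if no left-to-right
  maximum lies strictly between \<open>K\<close> and its index.\<close>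

lemma next_record_top_eq_UN_successors:
  assumes pp: "p \<in> permutations_of_set {1..Suc K}" and el: "eligible p" and K: "Suc K < N"
  shows "{\<pi> \<in> next_record_top N K. flatten_prefix (Suc K) \<pi> = p} =
         (\<Union>q\<in>successors (Av231 N) N p.
            {\<pi> \<in> Av231 N. flatten_prefix (length q) \<pi> = q \<and> \<pi> ! (length q - 1) = N})"
    (is "?L = ?R")
proof -
  have I: "Av231 N \<subseteq> permutations_of_set {1..N}" by (auto simp: Av231_def)
  have lp: "length p = Suc K" using permutation_of_interval(1)[OF pp] .
  \<comment> \<open>Sizes are one more than 0-based indices: sizes strictly between
    \<open>Suc K\<close> and \<open>Suc M\<close> belong to indices strictly between
    \<open>K\<close> and \<open>M\<close>. Indices below \<open>K\<close> are handled by eligibility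
    of \<open>p\<close>.\<close>
  have records: "(\<forall>j. Suc K < j \<and> j < Suc M \<longrightarrow> \<not> eligible (flatten_prefix j \<pi>)) \<longleftrightarrow>
      (\<forall>j. j < M \<and> j \<noteq> K \<longrightarrow> \<pi> ! j < \<pi> ! K)"
    if \<pi>: "\<pi> \<in> Av231 N" "flatten_prefix (Suc K) \<pi> = p" and M: "K < M" "M < N" for \<pi> M
  proof -
    note A = Av231_facts[OF \<pi>(1)]
    have max: "\<forall>i<K. \<pi> ! i < \<pi> ! K"
      using eligible_flatten_prefix_iff[OF A(2), of K] \<pi> el A(1) K by simp
    have "(\<forall>j. Suc K < j \<and> j < Suc M \<longrightarrow> \<not> eligible (flatten_prefix j \<pi>)) \<longleftrightarrow>
        (\<forall>j. K < j \<and> j < M \<longrightarrow> \<not> eligible (flatten_prefix (Suc j) \<pi>))"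
      by (metis Suc_less_eq Suc_less_eq2)
    also have "\<dots> \<longleftrightarrow> (\<forall>j. K < j \<and> j < M \<longrightarrow> \<not> (\<forall>i<j. \<pi> ! i < \<pi> ! j))"
      using eligible_flatten_prefix_iff[OF A(2)] A(1) M by (metis less_trans)
    also have "\<dots> \<longleftrightarrow> (\<forall>j. K < j \<and> j < M \<longrightarrow> \<pi> ! j < \<pi> ! K)"
      using no_record_between_iff[OF A(2) M(1) _ max] M A(1) by simp
    also have "\<dots> \<longleftrightarrow> (\<forall>j. j < M \<and> j \<noteq> K \<longrightarrow> \<pi> ! j < \<pi> ! K)"
      using max by (metis linorder_neqE_nat less_irrefl)
    finally show ?thesis .
  qed
  show ?thesis
  proof
    show "?L \<subseteq> ?R"
    proof
      fix \<pi> assume "\<pi> \<in> ?L"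
      then obtain M where \<pi>: "\<pi> \<in> Av231 N" "flatten_prefix (Suc K) \<pi> = p"
        and M: "K < M" "M < N" "\<pi> ! M = N"
        and max: "\<forall>j. j < M \<and> j \<noteq> K \<longrightarrow> \<pi> ! j < \<pi> ! K" by (auto simp: next_record_top_def)
      note A = Av231_facts[OF \<pi>(1)]
      have "\<pi> ! i < \<pi> ! M" if "i < M" for i
        using A(5)[of i] A(6)[of i M] that M by fastforce
      then have "eligible (flatten_prefix (Suc M) \<pi>)"
        using eligible_flatten_prefix_iff[OF A(2)] A(1) M by simp
      moreover have "\<not> eligible (flatten_prefix j \<pi>)" if "length p < j" "j < Suc M" for j
        using records[OF \<pi> M(1,2)] max that lp by simp
      ultimately have "flatten_prefix (Suc M) \<pi> \<in> successors (Av231 N) N p"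
        "length (flatten_prefix (Suc M) \<pi>) = Suc M"
        using flatten_prefix_mem_successors[OF I \<pi>(1), of p "Suc M"] \<pi>(2) lp M by auto
      then show "\<pi> \<in> ?R" using \<pi>(1) M(3) by (intro UN_I) auto
    qed
    show "?R \<subseteq> ?L"
    proof
      fix \<pi> assume "\<pi> \<in> ?R"
      then obtain q where q: "q \<in> successors (Av231 N) N p" "\<pi> \<in> Av231 N"
        "flatten_prefix (length q) \<pi> = q" and top: "\<pi> ! (length q - 1) = N" by auto
      note A = Av231_facts[OF q(2)]
      define M where "M = length q - 1"
      have M: "length q = Suc M" "K < M" "M < N"
        using q(1) lp unfolding M_def by (auto simp: successors_def is_prefix_def)
      have fl: "flatten_prefix (Suc K) \<pi> = p"
        using fibre_eq_UN_successors[OF I, of p] q lp K by auto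
      have "\<not> eligible (flatten_prefix j \<pi>)" if "Suc K < j" "j < Suc M" for j
        using q(1,3) that lp M A flatten_prefix_flatten_prefix[of \<pi> "length q" j]
        by (auto simp: successors_def)
      then have "\<forall>j. j < M \<and> j \<noteq> K \<longrightarrow> \<pi> ! j < \<pi> ! K"
        using records[OF q(2) fl M(2,3)] by blast
      then show "\<pi> \<in> ?L"
        using q(2) fl M top unfolding next_record_top_def M_def by auto
    qed
  qed
qed

text \<open>The condition \<open>length p < N\<close> keeps the sum from being empty: a prefix of
  size \<open>N\<close> has no successors, while its denominator is positive.\<close>

theorem theorem3p3:
  fixes N :: nat and p :: "nat list"
  assumes "N \<ge> 1"
    and "is_prefix (Av231 N) N p"
    and "eligible p"
    and "length p < N"
  shows "strike_prob (Av231 N) N p = (\<Sum>q\<in>successors (Av231 N) N p. strike_prob (Av231 N) N q)"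
proof -
  have I: "Av231 N \<subseteq> permutations_of_set {1..N}" by (auto simp: Av231_def)
  then have fin: "finite (Av231 N)" by (rule finite_subset) simp
  obtain K where lp: "length p = Suc K"
    using assms(2) by (cases "length p") (auto simp: is_prefix_def)
  have pp: "p \<in> permutations_of_set {1..Suc K}"
    using assms(2) lp by (simp add: is_prefix_def)
  have K: "Suc K < N" using assms(4) lp by simp
  let ?S = "successors (Av231 N) N p"
  let ?D = "\<lambda>q. {\<pi> \<in> Av231 N. flatten_prefix (length q) \<pi> = q}"
  let ?E = "\<lambda>q. {\<pi> \<in> Av231 N. flatten_prefix (length q) \<pi> = q \<and> \<pi> ! (length q - 1) = N}"
  have disj: "?D q \<inter> ?D q' = {}" if "q \<in> ?S" "q' \<in> ?S" "q \<noteq> q'" for q q'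
    using successors_disjoint[OF I that(1,2)] that(3) by blast
  have "card (?D p) = (\<Sum>q\<in>?S. card (?D q))"
    unfolding fibre_eq_UN_successors[OF I assms(4)]
    using fin disj by (intro card_UN_disjoint finite_successors) auto
  moreover have "card (?E p) = (\<Sum>q\<in>?S. card (?E q))"
  proof -
    have "card (?E p) = card (\<Union>q\<in>?S. ?E q)"
      using card_next_record_top[OF K, of p]
        next_record_top_eq_UN_successors[OF pp assms(3) K] lp by simp
    also have "\<dots> = (\<Sum>q\<in>?S. card (?E q))"
    proof (intro card_UN_disjoint finite_successors ballI impI)
      \<comment> \<open>\<open>?E q\<close> is contained in \<open>?D q\<close>, so disjointness
        carries over.\<close>
      fix q q' assume "q \<in> ?S" "q' \<in> ?S" "q \<noteq> q'"
      from disj[OF this] show "?E q \<inter> ?E q' = {}" by blast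
    qed (use fin in simp)
    finally show ?thesis .
  qed
  ultimately show ?thesis
    by (simp add: prod_eq_iff fst_sum snd_sum strike_prob_def)
qed

end
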